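(* Let $\mathcal{H}$ be a complex Hilbert space, let $T\in\mathcal{L}^h$ have closed range, let $T=T_1-T_2$ be its positive orthogonal decomposition and let $T=U_T-V$ be the polar proper splitting of $T$. The following assertions are equivalent: (1) the polar proper splitting of $T$ converges; (2) $\max\{\|P_{T_1}-T_1\|,\|P_{T_2}-T_2\|\}<1$; (3) $\|T_i\|<2$ for $i=1,2$.
   Context: $\mathcal{L}(\mathcal{H})$ is the algebra of bounded linear operators on $\mathcal{H}$; $\mathcal{L}^h$ and $\mathcal{L}^+$ are the sets of selfadjoint and positive (semidefinite) operators in it; $\mathcal{R}(\cdot)$, $\mathcal{N}(\cdot)$ denote range and nullspace; $\rho(\cdot)$ is the spectral radius; $P_A$ is the orthogonal projection onto $\overline{\mathcal{R}(A)}$; $A^\dagger$ is the Moore-Penrose inverse of a closed range operator $A$. A proper splitting of $T$ is a decomposition $T=U-V$ with $U,V\in\mathcal{L}(\mathcal{H})$, $\mathcal{R}(U)=\mathcal{R}(T)$, $\mathcal{N}(U)=\mathcal{N}(T)$; it converges if $\rho(U^\dagger V)<1$. The positive orthogonal decomposition of $T\in\mathcal{L}^h$ is the unique decomposition $T=T_1-T_2$ with $T_1,T_2\in\mathcal{L}^+$ and $\overline{\mathcal{R}(T_1)}\oplus\overline{\mathcal{R}(T_2)}=\overline{\mathcal{R}(T)}$ (orthogonal sum); explicitly $T_1=\frac{|T|+T}{2}$, $T_2=\frac{|T|-T}{2}$. The polar proper splitting of a closed range operator $T$ is $T=U_T-V$, where $U_T$ is the partial isometry of the polar decomposition $T=U_T|T|$,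 $|T|=(T^*T)^{1/2}$, $\mathcal{N}(U_T)=\mathcal{N}(T)$ (note $U_T^\dagger=U_T^*$). *)

theory Defs
  imports "HOL-Analysis.Analysis"
begin

text \<open>A complex Hilbert space is presented as a complete real inner product space carrying a
  compatible complex structure. Positive definiteness of \<open>cinner\<close>, and the fact that it induces
  the norm, follow from \<open>inner_eq_Re_cinner\<close> and the axioms of \<^class>\<open>real_inner\<close>.
  The form \<open>cinner\<close> is linear in the first argument.\<close>

class complex_hilbert_space = real_inner + complete_space +
  fixes scaleC :: "complex \<Rightarrow> 'a \<Rightarrow> 'a" (infixr "*\<^sub>C" 75)
    and cinner :: "'a \<Rightarrow> 'a \<Rightarrow> complex"
  assumes scaleC_add_right: "c *\<^sub>C (x + y) = c *\<^sub>C x + c *\<^sub>C y"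
    and scaleC_add_left: "(c + d) *\<^sub>C x = c *\<^sub>C x + d *\<^sub>C x"
    and scaleC_scaleC: "c *\<^sub>C d *\<^sub>C x = (c * d) *\<^sub>C x"
    and scaleC_of_real: "complex_of_real r *\<^sub>C x = r *\<^sub>R x"
    and cinner_commute: "cinner x y = cnj (cinner y x)"
    and cinner_add_left: "cinner (x + y) z = cinner x z + cinner y z"
    and cinner_scaleC_left: "cinner (c *\<^sub>C x) y = c * cinner x y"
    and inner_eq_Re_cinner: "inner x y = Re (cinner x y)"

instantiation complex :: complex_hilbert_space
begin

definition "c *\<^sub>C (x::complex) = c * x"
definition "cinner (x::complex) y = x * cnj y"

instance
  by standard
    (auto simp: scaleC_complex_def cinner_complex_def inner_complex_def scaleR_conv_of_real
      algebra_simps)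

end

text \<open>The algebra of bounded operators on \<open>H\<close> is the set of complex linear elements of
  the library type of bounded real linear maps; the operator norm does not depend on the
  scalar field.\<close>

definition bounded_ops :: "('a::complex_hilbert_space \<Rightarrow>\<^sub>L 'a) set" where
  "bounded_ops = {A :: 'a \<Rightarrow>\<^sub>L 'a. \<forall>c x. A (c *\<^sub>C x) = c *\<^sub>C A x}"

abbreviation op_range :: "('a::complex_hilbert_space \<Rightarrow>\<^sub>L 'a) \<Rightarrow> 'a set" where
  "op_range A \<equiv> range (blinfun_apply A)"

definition nullspace :: "('a::complex_hilbert_space \<Rightarrow>\<^sub>L 'a) \<Rightarrow> 'a set" where
  "nullspace A = {x. A x = 0}"

definition is_adjoint ::
  "('a::complex_hilbert_space \<Rightarrow>\<^sub>L 'a) \<Rightarrow> ('a \<Rightarrow>\<^sub>L 'a) \<Rightarrow> bool" where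
  "is_adjoint A B \<longleftrightarrow> (\<forall>x y. cinner (A x) y = cinner x (B y))"

definition adj :: "('a::complex_hilbert_space \<Rightarrow>\<^sub>L 'a) \<Rightarrow> ('a \<Rightarrow>\<^sub>L 'a)" where
  "adj A = (THE B. B \<in> bounded_ops \<and> is_adjoint A B)"

definition selfadjoint :: "('a::complex_hilbert_space \<Rightarrow>\<^sub>L 'a) \<Rightarrow> bool" where
  "selfadjoint A \<longleftrightarrow> A \<in> bounded_ops \<and> is_adjoint A A"

definition positive_op :: "('a::complex_hilbert_space \<Rightarrow>\<^sub>L 'a) \<Rightarrow> bool" where
  "positive_op A \<longleftrightarrow> selfadjoint A \<and> (\<forall>x. 0 \<le> Re (cinner (A x) x))"

definition op_sqrt :: "('a::complex_hilbert_space \<Rightarrow>\<^sub>L 'a) \<Rightarrow> ('a \<Rightarrow>\<^sub>L 'a)" where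
  "op_sqrt A = (THE B. positive_op B \<and> B o\<^sub>L B = A)"

definition op_abs :: "('a::complex_hilbert_space \<Rightarrow>\<^sub>L 'a) \<Rightarrow> ('a \<Rightarrow>\<^sub>L 'a)" where
  "op_abs T = op_sqrt (adj T o\<^sub>L T)"

definition orth_compl :: "'a::complex_hilbert_space set \<Rightarrow> 'a set" where
  "orth_compl M = {x. \<forall>y\<in>M. cinner x y = 0}"

text \<open>Meaningful for closed complex subspaces \<open>M\<close>.\<close>

definition orth_proj :: "'a::complex_hilbert_space set \<Rightarrow> ('a \<Rightarrow>\<^sub>L 'a)" where
  "orth_proj M = (THE P. P \<in> bounded_ops \<and> (\<forall>x. blinfun_apply P x \<in> M \<and> x - P x \<in> orth_compl M))"

definition range_proj :: "('a::complex_hilbert_space \<Rightarrow>\<^sub>L 'a) \<Rightarrow> ('a \<Rightarrow>\<^sub>L 'a)" where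
  "range_proj A = orth_proj (closure (op_range A))"

definition orthogonal_sum :: "'a::complex_hilbert_space set \<Rightarrow> 'a set \<Rightarrow> 'a set \<Rightarrow> bool" where
  "orthogonal_sum M N K \<longleftrightarrow>
    (\<forall>x\<in>M. \<forall>y\<in>N. cinner x y = 0) \<and> K = {x + y | x y. x \<in> M \<and> y \<in> N}"

definition positive_orthogonal_decomposition ::
  "('a::complex_hilbert_space \<Rightarrow>\<^sub>L 'a) \<Rightarrow> ('a \<Rightarrow>\<^sub>L 'a) \<Rightarrow> ('a \<Rightarrow>\<^sub>L 'a) \<Rightarrow> bool" where
  "positive_orthogonal_decomposition T T1 T2 \<longleftrightarrow>
    T = T1 - T2 \<and> positive_op T1 \<and> positive_op T2 \<and>
    orthogonal_sum (closure (op_range T1)) (closure (op_range T2)) (closure (op_range T))"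

text \<open>The Moore-Penrose inverse, determined by the four Penrose equations; meaningful for
  operators with closed range.\<close>

definition pinv :: "('a::complex_hilbert_space \<Rightarrow>\<^sub>L 'a) \<Rightarrow> ('a \<Rightarrow>\<^sub>L 'a)" where
  "pinv A = (THE X. X \<in> bounded_ops \<and> A o\<^sub>L X o\<^sub>L A = A \<and> X o\<^sub>L A o\<^sub>L X = X \<and>
    selfadjoint (A o\<^sub>L X) \<and> selfadjoint (X o\<^sub>L A))"

definition spectrum :: "('a::complex_hilbert_space \<Rightarrow>\<^sub>L 'a) \<Rightarrow> complex set" where
  "spectrum A = {c. \<not> (\<exists>B\<in>bounded_ops.
    \<forall>x. B (A x - c *\<^sub>C x) = x \<and> A (B x) - c *\<^sub>C B x = x)}"

text \<open>Inserting \<open>0\<close> only matters on the zero space, where the spectrum is empty and the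
  real supremum would be unspecified.\<close>

definition spectral_radius :: "('a::complex_hilbert_space \<Rightarrow>\<^sub>L 'a) \<Rightarrow> real" where
  "spectral_radius A = Sup (insert 0 (cmod ` spectrum A))"

definition proper_splitting ::
  "('a::complex_hilbert_space \<Rightarrow>\<^sub>L 'a) \<Rightarrow> ('a \<Rightarrow>\<^sub>L 'a) \<Rightarrow> ('a \<Rightarrow>\<^sub>L 'a) \<Rightarrow> bool" where
  "proper_splitting T U V \<longleftrightarrow> U \<in> bounded_ops \<and> V \<in> bounded_ops \<and> T = U - V \<and>
    op_range U = op_range T \<and> nullspace U = nullspace T"

definition convergent_proper_splitting ::
  "('a::complex_hilbert_space \<Rightarrow>\<^sub>L 'a) \<Rightarrow> ('a \<Rightarrow>\<^sub>L 'a) \<Rightarrow> ('a \<Rightarrow>\<^sub>L 'a) \<Rightarrow> bool" where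
  "convergent_proper_splitting T U V \<longleftrightarrow>
    proper_splitting T U V \<and> spectral_radius (pinv U o\<^sub>L V) < 1"

definition partial_isometry :: "('a::complex_hilbert_space \<Rightarrow>\<^sub>L 'a) \<Rightarrow> bool" where
  "partial_isometry U \<longleftrightarrow>
    U \<in> bounded_ops \<and> (\<forall>x\<in>orth_compl (nullspace U). norm (U x) = norm x)"

definition polar_isometry ::
  "('a::complex_hilbert_space \<Rightarrow>\<^sub>L 'a) \<Rightarrow> ('a \<Rightarrow>\<^sub>L 'a) \<Rightarrow> bool" where
  "polar_isometry T U \<longleftrightarrow>
    partial_isometry U \<and> T = U o\<^sub>L op_abs T \<and> nullspace U = nullspace T"

text \<open>For \<open>T\<close> with closed range the polar splitting is automatically a proper splitting;
  this is not built into the definition.\<close>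

definition polar_splitting ::
  "('a::complex_hilbert_space \<Rightarrow>\<^sub>L 'a) \<Rightarrow> ('a \<Rightarrow>\<^sub>L 'a) \<Rightarrow> ('a \<Rightarrow>\<^sub>L 'a) \<Rightarrow> bool" where
  "polar_splitting T U V \<longleftrightarrow> polar_isometry T U \<and> T = U - V"

end

theory Submission
  imports Defs
begin

text \<open>Since \<open>T1\<close> and \<open>T2\<close> annihilate each other, \<open>(T1 + T2)\<^sup>2 = T\<^sup>2\<close>, so \<open>\<bar>T\<bar> = T1 + T2\<close>. As the
  range of \<open>T\<close> is closed, so are those of \<open>T1\<close> and \<open>T2\<close>; with \<open>P1\<close>, \<open>P2\<close> the projections onto them,
  \<open>U = P1 - P2\<close> is its own Moore-Penrose inverse and \<open>U V = (P1 - T1) + (P2 - T2)\<close>. This operator is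
  selfadjoint, so its spectral radius is its norm, which is the maximum of the norms of the two
  summands because they live on orthogonal subspaces. On its closed range \<open>Ti\<close> is bounded below, so
  \<open>(norm (Ti x))\<^sup>2 \<le> norm Ti * inner (Ti x) x\<close> turns \<open>norm Ti < 2\<close> into \<open>norm (Pi - Ti) < 1\<close>.\<close>

section \<open>Symmetric operators on real inner product spaces\<close>

text \<open>A minimising sequence for the distance from \<open>x\<close> to \<open>M\<close> is
  Cauchy by the parallelogram law. Its limit is a nearest point, and minimality along every line in
  \<open>M\<close> through that point gives orthogonality.\<close>

lemma closed_subspace_decomposition:
  fixes M :: "'a::{real_inner, complete_space} set"
  assumes "closed M" and M: "subspace M"
  obtains m where "m \<in> M" and "\<And>y. y \<in> M \<Longrightarrow> inner (x - m) y = 0"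
proof -
  define D where "D = Inf ((\<lambda>m. (norm (x - m))\<^sup>2) ` M)"
  have "M \<noteq> {}"
    using subspace_0[OF M] by auto
  have lower: "D \<le> (norm (x - m))\<^sup>2" if "m \<in> M" for m
    unfolding D_def by (rule cINF_lower[OF _ that]) (auto intro!: bdd_belowI2[where m = 0])
  have "\<exists>m\<in>M. (norm (x - m))\<^sup>2 < D + 1 / real (Suc n)" for n
    using cInf_lessD[of "(\<lambda>m. (norm (x - m))\<^sup>2) ` M" "D + 1 / real (Suc n)"] \<open>M \<noteq> {}\<close>
    by (auto simp: D_def)
  then obtain m where mM: "\<And>n. m n \<in> M"
    and m: "\<And>n. (norm (x - m n))\<^sup>2 < D + 1 / real (Suc n)"
    by metis
  have parallelogram: "(norm (a - b))\<^sup>2 \<le> 2 * (norm (x - a))\<^sup>2 + 2 * (norm (x - b))\<^sup>2 - 4 * D"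
    if "a \<in> M" "b \<in> M" for a b
  proof -
    \<comment> \<open>Parallelogram law for \<open>x - a\<close> and \<open>x - b\<close>. The
      midpoint lies in \<open>M\<close>, so its term is at least \<open>4 * D\<close>.\<close>
    have "(norm (a - b))\<^sup>2 + 4 * (norm (x - (1/2) *\<^sub>R (a + b)))\<^sup>2
        = 2 * (norm (x - a))\<^sup>2 + 2 * (norm (x - b))\<^sup>2"
      by (simp add: power2_norm_eq_inner inner_simps inner_commute field_simps)
    moreover have "D \<le> (norm (x - (1/2) *\<^sub>R (a + b)))\<^sup>2"
      using that by (intro lower subspace_scale subspace_add M)
    ultimately show ?thesis
      by linarith
  qed
  have "Cauchy m"
  proof (rule metric_CauchyI)
    fix e :: real
    assume "0 < e"
    then obtain N where N: "1 / real (Suc N) < e\<^sup>2 / 4"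
      using reals_Archimedean[of "e\<^sup>2 / 4"] by (auto simp: inverse_eq_divide)
    have "dist (m i) (m j) < e" if "N \<le> i" "N \<le> j" for i j
    proof -
      have "1 / real (Suc i) \<le> 1 / real (Suc N)" "1 / real (Suc j) \<le> 1 / real (Suc N)"
        using that by (auto intro!: divide_left_mono)
      then have "(dist (m i) (m j))\<^sup>2 < e\<^sup>2"
        using parallelogram[OF mM mM, of i j] m[of i] m[of j] N unfolding dist_norm by linarith
      then show ?thesis
        using \<open>0 < e\<close> by (simp add: power_less_imp_less_base)
    qed
    then show "\<exists>N. \<forall>i\<ge>N. \<forall>j\<ge>N. dist (m i) (m j) < e"
      by blast
  qed
  then obtain l where l: "m \<longlonglongrightarrow> l"
    using Cauchy_convergent convergent_def by blast
  have "l \<in> M"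
    using closed_sequentially[OF \<open>closed M\<close> _ l] mM by blast
  have "(\<lambda>n. D + 1 / real (Suc n)) \<longlonglongrightarrow> D + 0"
    by (intro tendsto_intros LIMSEQ_Suc[OF lim_1_over_n])
  moreover have "(\<lambda>n. (norm (x - m n))\<^sup>2) \<longlonglongrightarrow> (norm (x - l))\<^sup>2"
    by (intro tendsto_intros l)
  ultimately have min: "(norm (x - l))\<^sup>2 \<le> D"
    using LIMSEQ_le[of "\<lambda>n. (norm (x - m n))\<^sup>2" _ "\<lambda>n. D + 1 / real (Suc n)" "D + 0"] less_imp_le[OF m]
    by simp
  have "inner (x - l) y = 0" if "y \<in> M" for y
  proof (cases "y = 0")
    case False
    \<comment> \<open>This \<open>t\<close> minimises the squared distance from \<open>x\<close> to
      \<open>l + t *\<^sub>R y\<close>.\<close>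
    define t where "t = inner (x - l) y / inner y y"
    have "D \<le> (norm (x - (l + t *\<^sub>R y)))\<^sup>2"
      using that \<open>l \<in> M\<close> by (intro lower subspace_scale subspace_add M)
    also have "\<dots> = (norm (x - l))\<^sup>2 - 2 * t * inner (x - l) y + t * (t * inner y y)"
      by (simp add: power2_norm_eq_inner inner_simps inner_commute algebra_simps)
    also have "t * inner y y = inner (x - l) y"
      using False by (simp add: t_def)
    finally have "t * inner (x - l) y \<le> 0"
      using min by simp
    then have "(inner (x - l) y)\<^sup>2 / inner y y \<le> 0"
      by (simp add: t_def power2_eq_square)
    moreover have "0 < inner y y"
      using False by simp
    ultimately show ?thesis
      by (simp add: divide_le_0_iff)
  qed simp
  with \<open>l \<in> M\<close> that show thesis
    by blast
qed

text \<open>A gliding hump argument replaces the open mapping theorem. If \<open>A\<close> shrinks unit vectors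
  \<open>e n\<close> of its range below \<open>(1/4)^n\<close>, signs can be chosen so that \<open>l = (\<Sum>n. \<plusminus>(1/3)^n e n)\<close>
  satisfies \<open>\<bar>inner l (e n)\<bar> \<ge> (1/3)^n / 2\<close>; but \<open>l = A z\<close> gives
  \<open>\<bar>inner l (e n)\<bar> \<le> norm z * (1/4)^n\<close>.\<close>

lemma symmetric_closed_range_bounded_below:
  fixes A :: "'a::{real_inner, complete_space} \<Rightarrow>\<^sub>L 'a"
  assumes sym: "\<And>x y. inner (A x) y = inner x (A y)"
    and closed: "closed (range (blinfun_apply A))"
  obtains c where "0 < c" and "\<And>x. x \<in> range (blinfun_apply A) \<Longrightarrow> c * norm x \<le> norm (A x)"
proof (rule ccontr)
  have sub: "subspace (range (blinfun_apply A))"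
    by (intro linear_subspace_image bounded_linear.linear blinfun.bounded_linear_right) simp
  assume "\<not> thesis"
  with that have small: "\<exists>x\<in>range (blinfun_apply A). norm (A x) < c * norm x" if "0 < c" for c
    using \<open>0 < c\<close> by (metis not_le)
  have "\<exists>e\<in>range (blinfun_apply A). norm e = 1 \<and> norm (A e) < (1/4)^n" for n
  proof -
    obtain x where x: "x \<in> range (blinfun_apply A)" "norm (A x) < (1/4)^n * norm x"
      using small[of "(1/4)^n"] by auto
    then have "x \<noteq> 0"
      by auto
    show ?thesis
    proof (intro bexI conjI)
      show "norm (x /\<^sub>R norm x) = 1"
        using \<open>x \<noteq> 0\<close> by simp
      show "norm (A (x /\<^sub>R norm x)) < (1/4)^n"
        using x(2) \<open>x \<noteq> 0\<close> by (simp add: blinfun.scaleR_right field_simps)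
      show "x /\<^sub>R norm x \<in> range (blinfun_apply A)"
        using x(1) by (intro subspace_scale[OF sub])
    qed
  qed
  then obtain e where e: "\<And>n. e n \<in> range (blinfun_apply A)" "\<And>n. norm (e n) = 1"
    "\<And>n. norm (A (e n)) < (1/4)^n"
    by metis
  \<comment> \<open>The sign follows that of \<open>inner (s n) (e n)\<close>, so the new term
    cannot cancel against the sum so far.\<close>
  define s where "s = rec_nat 0 (\<lambda>n v. v + (if 0 \<le> inner v (e n) then (1/3)^n else - ((1/3)^n)) *\<^sub>R e n)"
  have s0: "s 0 = 0"
    and s_Suc: "\<And>n. s (Suc n) = s n + (if 0 \<le> inner (s n) (e n) then (1/3)^n else - ((1/3)^n)) *\<^sub>R e n"
    by (simp_all add: s_def)
  have s_range: "s n \<in> range (blinfun_apply A)" for n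
  proof (induction n)
    case 0
    show ?case
      using subspace_0[OF sub] by (simp add: s0)
  next
    case (Suc n)
    then show ?case
      unfolding s_Suc by (intro subspace_add[OF sub] subspace_scale[OF sub] e)
  qed
  have hump: "(1/3)^n \<le> \<bar>inner (s (Suc n)) (e n)\<bar>" for n
  proof -
    have "inner (e n) (e n) = 1"
      using e(2)[of n] by (simp add: norm_eq_1)
    then show ?thesis
      by (auto simp: s_Suc inner_simps)
  qed
  \<comment> \<open>A geometric sum: step \<open>i\<close> has length \<open>(1/3)^i\<close>, and
    all steps from \<open>n\<close> on add up to \<open>3/2 * (1/3)^n\<close>. Subtracting the
    remainder lets the induction close.\<close>
  have tail: "norm (s (n + k) - s n) \<le> 3/2 * (1/3)^n - 3/2 * (1/3)^(n + k)" for n k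
  proof (induction k)
    case (Suc k)
    have "norm (s (n + Suc k) - s n) \<le> norm (s (Suc (n + k)) - s (n + k)) + norm (s (n + k) - s n)"
      using norm_triangle_ineq[of "s (Suc (n + k)) - s (n + k)" "s (n + k) - s n"] by simp
    also have "norm (s (Suc (n + k)) - s (n + k)) = (1/3)^(n + k)"
      by (simp add: s_Suc e)
    finally show ?case
      using Suc.IH by simp
  qed simp
  have tail': "norm (s m - s n) \<le> 3/2 * (1/3)^n" if "n \<le> m" for m n
  proof -
    have "norm (s m - s n) \<le> 3/2 * (1/3)^n - 3/2 * (1/3)^m"
      using tail[of n "m - n"] that by simp
    moreover have "0 \<le> (1/3::real)^m"
      by simp
    ultimately show ?thesis
      by linarith
  qed
  have "Cauchy s"
  proof (rule CauchyI')
    fix d :: real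
    assume "0 < d"
    then obtain N where N: "(1/3)^N < d * 2/3"
      using real_arch_pow_inv[of "d * 2/3" "1/3"] by auto
    have "norm (s i - s j) < d" if "N \<le> i" "i < j" for i j
    proof -
      have "norm (s i - s j) \<le> 3/2 * (1/3)^i"
        using tail'[of i j] that by (simp add: norm_minus_commute)
      also have "(1/3::real)^i \<le> (1/3)^N"
        using that by (intro power_decreasing) auto
      finally show ?thesis
        using N by simp
    qed
    then show "\<exists>N. \<forall>i\<ge>N. \<forall>j>i. dist (s i) (s j) < d"
      unfolding dist_norm by blast
  qed
  then obtain l where l: "s \<longlonglongrightarrow> l"
    using Cauchy_convergent convergent_def by blast
  then have "l \<in> range (blinfun_apply A)"
    using closed_sequentially[OF closed] s_range by blast
  then obtain z where z: "l = A z"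
    by blast
  \<comment> \<open>What follows hump \<open>n\<close> contributes at most half of it, because
    \<open>3/2 * (1/3)^Suc n = 1/2 * (1/3)^n\<close>.\<close>
  have "(4/3)^n \<le> 2 * norm z" for n
  proof -
    have "(\<lambda>m. norm (s m - s (Suc n))) \<longlonglongrightarrow> norm (l - s (Suc n))"
      by (intro tendsto_intros l)
    moreover have "\<exists>N. \<forall>m\<ge>N. norm (s m - s (Suc n)) \<le> 3/2 * (1/3)^Suc n"
      using tail'[of "Suc n"] by blast
    ultimately have "norm (l - s (Suc n)) \<le> 3/2 * (1/3)^Suc n"
      by (rule LIMSEQ_le_const2)
    then have "\<bar>inner (l - s (Suc n)) (e n)\<bar> \<le> 1/2 * (1/3)^n"
      using Cauchy_Schwarz_ineq2[of "l - s (Suc n)" "e n"] by (simp add: e)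
    then have "1/2 * (1/3)^n \<le> \<bar>inner l (e n)\<bar>"
      using hump[of n] unfolding inner_diff_left by linarith
    also have "\<dots> = \<bar>inner z (A (e n))\<bar>"
      by (simp add: z sym)
    also have "\<dots> \<le> norm z * norm (A (e n))"
      by (rule Cauchy_Schwarz_ineq2)
    also have "\<dots> \<le> norm z * (1/4)^n"
      using e(3)[of n] by (intro mult_left_mono) auto
    finally show ?thesis
      by (simp add: power_divide field_simps)
  qed
  moreover obtain n where "2 * norm z < (4/3)^n"
    using real_arch_pow[of "4/3"] by auto
  ultimately show False
    by (meson not_le)
qed

text \<open>Equivalently, \<open>(norm A)\<^sup>2\<close> is an approximate eigenvalue of \<open>A\<^sup>2\<close>: expanding
  \<open>(norm (A (A x) - (norm A)\<^sup>2 x))\<^sup>2\<close> gives at most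
  \<open>(norm A)^4 (norm x)\<^sup>2 - (norm A)\<^sup>2 (norm (A x))\<^sup>2\<close>.\<close>

lemma symmetric_eq_0_if_square_bounded_below:
  fixes A :: "'a::real_inner \<Rightarrow>\<^sub>L 'a"
  assumes sym: "\<And>x y. inner (A x) y = inner x (A y)"
    and "0 < k" and k: "\<And>x. k * norm x \<le> norm (A (A x) - (norm A)\<^sup>2 *\<^sub>R x)"
  shows "A = 0"
proof (rule ccontr)
  assume "A \<noteq> 0"
  define L where "L = norm A"
  have "0 < L"
    using \<open>A \<noteq> 0\<close> by (simp add: L_def)
  \<comment> \<open>Since \<open>norm (A (A x)) \<le> L * norm (A x)\<close>, the hypothesis yields
    \<open>L^2 * (norm (A x))^2 \<le> (L^4 - k^2) * (norm x)^2\<close>; dividing by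
    \<open>L^2\<close> produces \<open>q\<close>, which is strictly below
    \<open>L^2\<close>.\<close>
  define q where "q = L\<^sup>2 - k\<^sup>2 / L\<^sup>2"
  have bound: "(norm (A x))\<^sup>2 \<le> q * (norm x)\<^sup>2" for x
  proof -
    have "norm (A (A x)) \<le> L * norm (A x)"
      unfolding L_def by (rule norm_blinfun)
    then have AA: "(norm (A (A x)))\<^sup>2 \<le> L\<^sup>2 * (norm (A x))\<^sup>2"
      by (metis norm_ge_zero power_mono power_mult_distrib)
    have "k\<^sup>2 * (norm x)\<^sup>2 \<le> (norm (A (A x) - L\<^sup>2 *\<^sub>R x))\<^sup>2"
      using power_mono[OF k[of x], of 2] \<open>0 < k\<close> by (simp add: power_mult_distrib L_def)
    also have "\<dots> = (norm (A (A x)))\<^sup>2 - 2 * L\<^sup>2 * (norm (A x))\<^sup>2 + L\<^sup>2 * L\<^sup>2 * (norm x)\<^sup>2"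
      unfolding power2_norm_eq_inner
      by (simp add: inner_simps inner_commute sym algebra_simps)
    finally have "L\<^sup>2 * (norm (A x))\<^sup>2 \<le> (L\<^sup>2 * L\<^sup>2 - k\<^sup>2) * (norm x)\<^sup>2"
      using AA by (simp add: algebra_simps)
    then show ?thesis
      using \<open>0 < L\<close> by (simp add: q_def field_simps power2_eq_square)
  qed
  \<comment> \<open>The sign of \<open>q\<close> has not been determined, hence the maximum under
    the root.\<close>
  have "norm A \<le> sqrt (max 0 q)"
  proof (rule norm_blinfun_bound)
    fix x
    have "(norm (A x))\<^sup>2 \<le> max 0 q * (norm x)\<^sup>2"
      using bound[of x] by (rule order_trans) (intro mult_right_mono, auto)
    then have "norm (A x) \<le> sqrt (max 0 q * (norm x)\<^sup>2)"
      by (rule real_le_rsqrt)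
    then show "norm (A x) \<le> sqrt (max 0 q) * norm x"
      by (simp add: real_sqrt_mult)
  qed simp
  then have "L\<^sup>2 \<le> max 0 q"
    unfolding L_def by (metis real_sqrt_le_iff real_sqrt_abs abs_norm_cancel)
  moreover have "max 0 q < L\<^sup>2"
    using \<open>0 < k\<close> \<open>0 < L\<close> by (simp add: q_def)
  ultimately show False
    by simp
qed

text \<open>Positivity is applied to \<open>x - t *\<^sub>R A x\<close> with
  \<open>t = 1 / norm A\<close>; the term quadratic in \<open>t\<close> is at most
  \<open>t * (norm (A x))^2\<close> and so absorbs only half of the linear one.\<close>

lemma positive_norm_square_le:
  fixes A :: "'a::real_inner \<Rightarrow>\<^sub>L 'a"
  assumes sym: "\<And>x y. inner (A x) y = inner x (A y)" and pos: "\<And>x. 0 \<le> inner (A x) x"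
  shows "(norm (A x))\<^sup>2 \<le> norm A * inner (A x) x"
proof (cases "A = 0")
  case False
  define L where "L = norm A"
  have "0 < L"
    using False by (simp add: L_def)
  define t where "t = 1 / L"
  have t: "0 \<le> t" "t * L = 1"
    using \<open>0 < L\<close> by (simp_all add: t_def)
  have "inner (A (A x)) (A x) \<le> norm (A (A x)) * norm (A x)"
    by (rule norm_cauchy_schwarz)
  also have "\<dots> \<le> L * norm (A x) * norm (A x)"
    unfolding L_def by (intro mult_right_mono norm_blinfun) simp
  finally have "t\<^sup>2 * inner (A (A x)) (A x) \<le> t\<^sup>2 * (L * (norm (A x))\<^sup>2)"
    by (intro mult_left_mono) (auto simp: power2_eq_square algebra_simps)
  also have "\<dots> = t * (norm (A x))\<^sup>2"
    using t by (simp add: power2_eq_square algebra_simps)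
  finally have "t\<^sup>2 * inner (A (A x)) (A x) \<le> t * (norm (A x))\<^sup>2" .
  moreover have "0 \<le> inner (A (x - t *\<^sub>R A x)) (x - t *\<^sub>R A x)"
    by (rule pos)
  moreover have "inner (A (x - t *\<^sub>R A x)) (x - t *\<^sub>R A x)
      = inner (A x) x - 2 * t * (norm (A x))\<^sup>2 + t\<^sup>2 * inner (A (A x)) (A x)"
    unfolding power2_norm_eq_inner
    by (simp add: blinfun.bilinear_simps inner_simps sym inner_commute power2_eq_square algebra_simps)
  ultimately have "t * (norm (A x))\<^sup>2 \<le> inner (A x) x"
    by simp
  then show ?thesis
    using \<open>0 < L\<close> by (simp add: t_def L_def field_simps)
qed simp

section \<open>Selfadjoint and positive operators\<close>

lemma cinner_scaleC_right: "cinner x (c *\<^sub>C y) = cnj c * cinner x y"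
  by (metis cinner_commute cinner_scaleC_left complex_cnj_mult)

text \<open>Together with \<open>inner_eq_Re_cinner\<close> this recovers the complex form from the
  real one, so that orthogonality and symmetry can be checked with \<open>inner\<close>.\<close>

lemma Im_cinner: "Im (cinner x y) = inner x (\<i> *\<^sub>C y)"
  by (simp add: inner_eq_Re_cinner cinner_scaleC_right)

lemma inner_scaleC_right: "inner x (c *\<^sub>C y) = inner (cnj c *\<^sub>C x) y"
  by (simp add: inner_eq_Re_cinner cinner_scaleC_right cinner_scaleC_left)

lemma norm_scaleC: "norm (c *\<^sub>C x) = cmod c * norm x"
proof -
  have "(norm (c *\<^sub>C x))\<^sup>2 = inner ((cnj c * c) *\<^sub>C x) x"
    by (simp add: power2_norm_eq_inner inner_scaleC_right scaleC_scaleC)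
  also have "cnj c * c = complex_of_real ((cmod c)\<^sup>2)"
    by (metis complex_norm_square mult.commute)
  also have "inner (\<dots> *\<^sub>C x) x = (cmod c * norm x)\<^sup>2"
    by (simp only: scaleC_of_real) (simp add: power_mult_distrib power2_norm_eq_inner)
  finally show ?thesis
    by (simp add: power2_eq_iff_nonneg)
qed

lemma scaleC_diff_right: "c *\<^sub>C (x - y) = c *\<^sub>C x - c *\<^sub>C y"
  by (metis add_diff_cancel_right' diff_add_cancel scaleC_add_right)

lemma scaleC_1: "1 *\<^sub>C x = x"
  using scaleC_of_real[of 1 x] by simp

lemma bounded_ops_scaleC: "A \<in> bounded_ops \<Longrightarrow> A (c *\<^sub>C x) = c *\<^sub>C A x"
  by (simp add: bounded_ops_def)

lemma bounded_ops_add: "A \<in> bounded_ops \<Longrightarrow> B \<in> bounded_ops \<Longrightarrow> A + B \<in> bounded_ops"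
  by (simp add: bounded_ops_def blinfun.add_left scaleC_add_right)

lemma bounded_ops_diff: "A \<in> bounded_ops \<Longrightarrow> B \<in> bounded_ops \<Longrightarrow> A - B \<in> bounded_ops"
  by (simp add: bounded_ops_def blinfun.diff_left scaleC_diff_right)

text \<open>By complex linearity, replacing \<open>y\<close> by \<open>\<i> *\<^sub>C y\<close>
  turns the identity of real parts into that of imaginary parts.\<close>

lemma selfadjoint_iff_inner:
  "selfadjoint A \<longleftrightarrow> A \<in> bounded_ops \<and> (\<forall>x y. inner (A x) y = inner x (A y))"
proof -
  have "cinner (A x) y = cinner x (A y)"
    if "A \<in> bounded_ops" "\<forall>x y. inner (A x) y = inner x (A y)" for x y
    using that by (intro complex_eqI) (simp_all add: Im_cinner bounded_ops_def flip: inner_eq_Re_cinner)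
  then show ?thesis
    by (auto simp: selfadjoint_def is_adjoint_def inner_eq_Re_cinner)
qed

lemma selfadjoint_bounded_ops: "selfadjoint A \<Longrightarrow> A \<in> bounded_ops"
  by (simp add: selfadjoint_def)

lemma selfadjoint_inner: "selfadjoint A \<Longrightarrow> inner (A x) y = inner x (A y)"
  by (simp add: selfadjoint_iff_inner)

lemma selfadjoint_add: "selfadjoint A \<Longrightarrow> selfadjoint B \<Longrightarrow> selfadjoint (A + B)"
  by (simp add: selfadjoint_iff_inner bounded_ops_add blinfun.add_left inner_simps)

lemma selfadjoint_diff: "selfadjoint A \<Longrightarrow> selfadjoint B \<Longrightarrow> selfadjoint (A - B)"
  by (simp add: selfadjoint_iff_inner bounded_ops_diff blinfun.diff_left inner_simps)

text \<open>The adjoint of a product of selfadjoint operators is the product in reverse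
  order.\<close>

lemma selfadjoint_compose_commute:
  assumes A: "selfadjoint A" and B: "selfadjoint B" and AB: "selfadjoint (A o\<^sub>L B)"
  shows "A o\<^sub>L B = B o\<^sub>L A"
proof (rule blinfun_eqI)
  fix x
  have "inner ((A o\<^sub>L B) x) y = inner ((B o\<^sub>L A) x) y" for y
    using selfadjoint_inner[OF AB, of x y] by (simp add: selfadjoint_inner A B)
  then show "(A o\<^sub>L B) x = (B o\<^sub>L A) x"
    using vector_eq_rdot by blast
qed

lemma positive_op_iff_inner:
  "positive_op A \<longleftrightarrow> selfadjoint A \<and> (\<forall>x. 0 \<le> inner (A x) x)"
  by (simp add: positive_op_def inner_eq_Re_cinner)

lemma positive_op_add: "positive_op A \<Longrightarrow> positive_op B \<Longrightarrow> positive_op (A + B)"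
  by (auto simp: positive_op_iff_inner selfadjoint_add blinfun.add_left inner_simps)

lemma adj_selfadjoint:
  assumes "selfadjoint A"
  shows "adj A = A"
  unfolding adj_def
proof (rule the_equality)
  show "A \<in> bounded_ops \<and> is_adjoint A A"
    using assms by (simp add: selfadjoint_def)
next
  fix B
  assume B: "B \<in> bounded_ops \<and> is_adjoint A B"
  show "B = A"
  proof (rule blinfun_eqI)
    fix y
    have "inner x (B y) = inner x (A y)" for x
      using B selfadjoint_inner[OF assms, of x y] by (simp add: is_adjoint_def inner_eq_Re_cinner)
    then show "B y = A y"
      using vector_eq_ldot by blast
  qed
qed

text \<open>\<open>D = A - B\<close> anticommutes with \<open>S = A + B\<close>, and \<open>\<bar>inner (D y) y\<bar> \<le> inner (S y) y\<close>.
  If \<open>D y\<close> is close to \<open>\<mu> y\<close>, the first fact makes \<open>\<mu> * inner (S y) y\<close> small, the second keeps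
  it away from 0. The vectors \<open>D x \<plusminus> norm D *\<^sub>R x\<close> serve as approximate eigenvectors.\<close>

lemma positive_op_sqrt_unique:
  assumes A: "positive_op A" and B: "positive_op B" and eq: "A o\<^sub>L A = B o\<^sub>L B"
  shows "A = B"
proof -
  define D where "D = A - B"
  define S where "S = A + B"
  define L where "L = norm D"
  have symA: "selfadjoint A" "selfadjoint B"
    using A B by (auto simp: positive_op_def)
  have sym: "selfadjoint D" "selfadjoint S"
    unfolding D_def S_def by (intro selfadjoint_diff selfadjoint_add symA)+
  have eq': "A (A x) = B (B x)" for x
    using arg_cong[OF eq, of "\<lambda>X. blinfun_apply X x"] by simp
  \<comment> \<open>The sum of the two products is \<open>2 * (A^2 - B^2)\<close>; the mixed terms
    cancel without \<open>A\<close> and \<open>B\<close> commuting.\<close>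
  have anti: "S (D x) + D (S x) = 0" for x
    by (simp add: S_def D_def blinfun.bilinear_simps eq')
  have absD: "\<bar>inner (D y) y\<bar> \<le> inner (S y) y" for y
    using A B by (simp add: S_def D_def positive_op_iff_inner blinfun.bilinear_simps inner_simps abs_le_iff)
  have approx: "L\<^sup>2 * norm y \<le> (norm S + L) * norm (D y - \<mu> *\<^sub>R y)"
    if mu: "\<bar>\<mu>\<bar> = L" for \<mu> y
  proof (cases "y = 0")
    case False
    define r where "r = D y - \<mu> *\<^sub>R y"
    have Dy: "D y = \<mu> *\<^sub>R y + r"
      by (simp add: r_def)
    have "inner (S y) (D y) + inner (S y) (D y) = inner (S (D y) + D (S y)) y"
      using selfadjoint_inner[OF sym(1), of "S y" y] selfadjoint_inner[OF sym(2), of "D y" y]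
      by (simp add: inner_add_left inner_commute[of "S y" "D y"])
    also have "\<dots> = 0"
      by (simp add: anti)
    finally have "\<mu> * inner (S y) y = - inner (S y) r"
      by (simp add: Dy inner_simps)
    then have "L * inner (S y) y = \<bar>inner (S y) r\<bar>"
      using absD[of y] by (simp add: abs_mult flip: mu)
        (metis abs_minus_cancel abs_mult abs_of_nonneg abs_ge_zero order_trans)
    also have "\<dots> \<le> norm (S y) * norm r"
      by (rule Cauchy_Schwarz_ineq2)
    also have "\<dots> \<le> norm S * norm y * norm r"
      by (intro mult_right_mono norm_blinfun) simp
    finally have 1: "L * inner (S y) y \<le> norm S * norm y * norm r" .
    have "inner (D y) y = \<mu> * (norm y)\<^sup>2 + inner r y"
      by (simp add: Dy inner_simps power2_norm_eq_inner)
    then have "L * (norm y)\<^sup>2 \<le> \<bar>inner (D y) y\<bar> + \<bar>inner r y\<bar>"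
      using abs_mult[of \<mu> "(norm y)\<^sup>2"] mu by simp
    also have "\<dots> \<le> inner (S y) y + norm r * norm y"
      by (intro add_mono absD Cauchy_Schwarz_ineq2)
    finally have "L * (L * (norm y)\<^sup>2) \<le> L * (inner (S y) y + norm r * norm y)"
      by (intro mult_left_mono) (auto simp: L_def)
    then have "norm y * (L\<^sup>2 * norm y) \<le> norm y * ((norm S + L) * norm r)"
      using 1 by (simp add: power2_eq_square algebra_simps)
    then show ?thesis
      using False by (simp add: r_def)
  qed simp
  have "D = 0"
  proof (rule ccontr)
    assume "D \<noteq> 0"
    then have "0 < L"
      by (simp add: L_def)
    define K where "K = norm S + L"
    have "0 < K"
      using \<open>0 < L\<close> by (simp add: K_def add_nonneg_pos)
    have "D = 0"
    proof (rule symmetric_eq_0_if_square_bounded_below)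
      \<comment> \<open>The constant results from adding the estimates for \<open>y\<close> and
        \<open>z\<close> below: as \<open>y - z = (2 * L) *\<^sub>R x\<close>, both cannot be small,
        while \<open>D y - L *\<^sub>R y\<close> and \<open>D z + L *\<^sub>R z\<close> both equal
        \<open>r\<close>.\<close>
      show "0 < L ^ 3 / K"
        using \<open>0 < L\<close> \<open>0 < K\<close> by simp
      fix x
      define r where "r = D (D x) - L\<^sup>2 *\<^sub>R x"
      define y where "y = D x + L *\<^sub>R x"
      define z where "z = D x - L *\<^sub>R x"
      have "L\<^sup>2 * norm y \<le> (norm S + L) * norm r"
        using approx[of L y] \<open>0 < L\<close>
        by (simp add: r_def y_def blinfun.bilinear_simps algebra_simps power2_eq_square)
      moreover have "L\<^sup>2 * norm z \<le> (norm S + L) * norm r"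
        using approx[of "- L" z] \<open>0 < L\<close>
        by (simp add: r_def z_def blinfun.bilinear_simps algebra_simps power2_eq_square)
      moreover have "2 * L * norm x \<le> norm y + norm z"
      proof -
        have "(2 * L) *\<^sub>R x = y - z"
          by (simp add: y_def z_def scaleR_2 flip: scaleR_scaleR)
        then have "norm ((2 * L) *\<^sub>R x) \<le> norm y + norm z"
          by (metis norm_triangle_ineq4)
        then show ?thesis
          using \<open>0 < L\<close> by simp
      qed
      then have "L\<^sup>2 * (2 * L * norm x) \<le> L\<^sup>2 * (norm y + norm z)"
        by (intro mult_left_mono) auto
      ultimately have "L ^ 3 * norm x \<le> (norm S + L) * norm r"
        by (simp add: power2_eq_square power3_eq_cube algebra_simps)
      then show "L ^ 3 / K * norm x \<le> norm (D (D x) - (norm D)\<^sup>2 *\<^sub>R x)"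
        using \<open>0 < K\<close> by (simp add: r_def L_def K_def field_simps)
    qed (rule selfadjoint_inner[OF sym(1)])
    then show False
      using \<open>D \<noteq> 0\<close> by simp
  qed
  then show ?thesis
    by (simp add: D_def)
qed

lemma op_sqrt_eqI: "positive_op B \<Longrightarrow> B o\<^sub>L B = A \<Longrightarrow> op_sqrt A = B"
  unfolding op_sqrt_def by (rule the_equality) (auto intro: positive_op_sqrt_unique)

text \<open>Penrose's uniqueness argument: \<open>A X = (A Y) (A X)\<close> and
  \<open>A Y = (A X) (A Y)\<close>, and these selfadjoint factors commute, so
  \<open>A X = A Y\<close>. Likewise \<open>X A = Y A\<close>, whence
  \<open>Y = Y A Y = X A X = X\<close>.\<close>

lemma pinv_eqI:
  assumes X: "X \<in> bounded_ops" "A o\<^sub>L X o\<^sub>L A = A" "X o\<^sub>L A o\<^sub>L X = X"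
    "selfadjoint (A o\<^sub>L X)" "selfadjoint (X o\<^sub>L A)"
  shows "pinv A = X"
  unfolding pinv_def
proof (rule the_equality)
  fix Y
  assume Y: "Y \<in> bounded_ops \<and> A o\<^sub>L Y o\<^sub>L A = A \<and> Y o\<^sub>L A o\<^sub>L Y = Y \<and>
    selfadjoint (A o\<^sub>L Y) \<and> selfadjoint (Y o\<^sub>L A)"
  have assoc: "(P o\<^sub>L Q) o\<^sub>L R = P o\<^sub>L (Q o\<^sub>L R)" for P Q R :: "'a \<Rightarrow>\<^sub>L 'a"
    by (rule blinfun_eqI) simp
  have "A o\<^sub>L X = (A o\<^sub>L Y) o\<^sub>L (A o\<^sub>L X)" "A o\<^sub>L Y = (A o\<^sub>L X) o\<^sub>L (A o\<^sub>L Y)"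
    using X Y by (metis assoc)+
  then have AX: "A o\<^sub>L Y = A o\<^sub>L X"
    using selfadjoint_compose_commute[of "A o\<^sub>L Y" "A o\<^sub>L X"] X Y by simp
  have "X o\<^sub>L A = (X o\<^sub>L A) o\<^sub>L (Y o\<^sub>L A)" "Y o\<^sub>L A = (Y o\<^sub>L A) o\<^sub>L (X o\<^sub>L A)"
    using X Y by (metis assoc)+
  then have "Y o\<^sub>L A = X o\<^sub>L A"
    using selfadjoint_compose_commute[of "X o\<^sub>L A" "Y o\<^sub>L A"] X Y by simp
  then show "Y = X"
    using X Y AX by (metis assoc)
qed (use X in simp)

text \<open>Solving \<open>A x - c *\<^sub>C x = y\<close> is a fixed point problem for a
  contraction with constant \<open>norm A / cmod c\<close>. Uniqueness makes the solution map
  \<open>g\<close> complex linear, and \<open>(cmod c - norm A) * norm (g y) \<le> norm y\<close>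
  makes it bounded.\<close>

lemma not_in_spectrum_if_norm_less:
  assumes A: "A \<in> bounded_ops" and c: "norm A < cmod c"
  shows "c \<notin> spectrum A"
proof -
  have "c \<noteq> 0"
    using c by auto
  have solve: "\<exists>!x. A x - c *\<^sub>C x = y" for y
  proof -
    have "\<exists>!x. inverse c *\<^sub>C (A x - y) = x"
    proof (rule banach_fix_type)
      show "norm A / cmod c < 1"
        using c \<open>c \<noteq> 0\<close> by simp
      show "\<forall>x x'. dist (inverse c *\<^sub>C (A x - y)) (inverse c *\<^sub>C (A x' - y)) \<le> norm A / cmod c * dist x x'"
      proof (intro allI)
        fix x x'
        have "dist (inverse c *\<^sub>C (A x - y)) (inverse c *\<^sub>C (A x' - y)) = norm (A (x - x')) / cmod c"
          by (simp add: dist_norm norm_scaleC norm_inverse blinfun.diff_right divide_inverse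
              flip: scaleC_diff_right)
        also have "\<dots> \<le> norm A * norm (x - x') / cmod c"
          by (intro divide_right_mono norm_blinfun) simp
        finally show "dist (inverse c *\<^sub>C (A x - y)) (inverse c *\<^sub>C (A x' - y)) \<le> norm A / cmod c * dist x x'"
          by (simp add: dist_norm)
      qed
    qed simp
    moreover have "inverse c *\<^sub>C (A x - y) = x \<longleftrightarrow> A x - c *\<^sub>C x = y" for x
    proof -
      have "inverse c *\<^sub>C (A x - y) = x \<longleftrightarrow> A x - y = c *\<^sub>C x"
        using \<open>c \<noteq> 0\<close>
        by (metis left_inverse right_inverse scaleC_1 scaleC_scaleC)
      then show ?thesis
        by (auto simp: algebra_simps)
    qed
    ultimately show ?thesis
      by simp
  qed
  then obtain g where g: "\<And>y. A (g y) - c *\<^sub>C g y = y"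
    and g_unique: "\<And>x y. A x - c *\<^sub>C x = y \<Longrightarrow> x = g y"
    by metis
  have g_scaleC: "g (d *\<^sub>C y) = d *\<^sub>C g y" for d y
  proof (rule g_unique[symmetric])
    have "A (d *\<^sub>C g y) - c *\<^sub>C d *\<^sub>C g y = d *\<^sub>C (A (g y) - c *\<^sub>C g y)"
      by (simp add: bounded_ops_scaleC[OF A] scaleC_diff_right scaleC_scaleC mult.commute)
    then show "A (d *\<^sub>C g y) - c *\<^sub>C d *\<^sub>C g y = d *\<^sub>C y"
      by (simp add: g)
  qed
  have "bounded_linear g"
  proof (rule bounded_linear_intro)
    fix x y
    have "A (g x + g y) - c *\<^sub>C (g x + g y) = (A (g x) - c *\<^sub>C g x) + (A (g y) - c *\<^sub>C g y)"
      by (simp add: blinfun.add_right scaleC_add_right)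
    then show "g (x + y) = g x + g y"
      by (intro g_unique[symmetric]) (simp add: g)
  next
    fix r :: real and x
    show "g (r *\<^sub>R x) = r *\<^sub>R g x"
      using g_scaleC[of "of_real r" x] by (simp add: scaleC_of_real)
  next
    fix y
    have "cmod c * norm (g y) \<le> norm (A (g y)) + norm y"
      using norm_triangle_ineq4[of "A (g y)" y] g[of y]
      by (metis add_diff_cancel_left' diff_add_cancel norm_scaleC)
    also have "\<dots> \<le> norm A * norm (g y) + norm y"
      by (intro add_right_mono norm_blinfun)
    finally show "norm (g y) \<le> norm y * (1 / (cmod c - norm A))"
      using c by (simp add: field_simps)
  qed
  then have Bg: "blinfun_apply (Blinfun g) = g"
    by (rule bounded_linear_Blinfun_apply)
  have "Blinfun g \<in> bounded_ops"
    by (simp add: bounded_ops_def Bg g_scaleC)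
  moreover have "\<forall>x. g (A x - c *\<^sub>C x) = x \<and> A (g x) - c *\<^sub>C g x = x"
    by (metis g g_unique)
  ultimately show ?thesis
    unfolding spectrum_def by (auto simp: Bg intro!: bexI[of _ "Blinfun g"])
qed

text \<open>If neither \<open>norm A\<close> nor \<open>- norm A\<close> were in the spectrum,
  composing left inverses of the two shifted operators would bound \<open>A^2 - (norm A)^2\<close>
  below, forcing \<open>A = 0\<close>.\<close>

lemma selfadjoint_norm_in_spectrum:
  assumes A: "selfadjoint A" and "A \<noteq> 0"
  shows "\<exists>c\<in>spectrum A. cmod c = norm A"
proof (rule ccontr)
  assume none: "\<not> ?thesis"
  define L where "L = norm A"
  have "complex_of_real L \<notin> spectrum A" "complex_of_real (- L) \<notin> spectrum A"
    using none by (auto simp: L_def simp del: of_real_minus)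
  then obtain B C :: "'a \<Rightarrow>\<^sub>L 'a" where "\<forall>x. B (A x - complex_of_real L *\<^sub>C x) = x"
    and "\<forall>x. C (A x - complex_of_real (- L) *\<^sub>C x) = x"
    unfolding spectrum_def by blast
  then have B: "\<And>x. B (A x - L *\<^sub>R x) = x" and C: "\<And>x. C (A x + L *\<^sub>R x) = x"
    by (simp_all only: scaleC_of_real) simp_all
  define K where "K = norm C * norm B + 1"
  have "0 < K"
    by (simp add: K_def add_nonneg_pos)
  have "A = 0"
  proof (rule symmetric_eq_0_if_square_bounded_below)
    show "0 < 1 / K"
      using \<open>0 < K\<close> by simp
    fix x
    define r where "r = A (A x) - L\<^sup>2 *\<^sub>R x"
    have "r = A (A x + L *\<^sub>R x) - L *\<^sub>R (A x + L *\<^sub>R x)"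
      by (simp add: r_def blinfun.bilinear_simps algebra_simps power2_eq_square)
    then have "x = C (B r)"
      by (simp add: B C)
    then have "norm x \<le> norm C * norm (B r)"
      by (metis norm_blinfun)
    also have "\<dots> \<le> norm C * (norm B * norm r)"
      by (intro mult_left_mono norm_blinfun) simp
    also have "\<dots> \<le> K * norm r"
      by (simp add: K_def algebra_simps)
    finally show "1 / K * norm x \<le> norm (A (A x) - (norm A)\<^sup>2 *\<^sub>R x)"
      using \<open>0 < K\<close> by (simp add: r_def L_def field_simps)
  qed (rule selfadjoint_inner[OF A])
  then show False
    using \<open>A \<noteq> 0\<close> by simp
qed

text \<open>The norm bounds the spectrum and is attained on it; for \<open>A = 0\<close> the
  inserted \<open>0\<close> is the maximum.\<close>

lemma selfadjoint_spectral_radius: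
  assumes A: "selfadjoint A"
  shows "spectral_radius A = norm A"
proof -
  have bound: "r \<le> norm A" if "r \<in> insert 0 (cmod ` spectrum A)" for r
    using that not_in_spectrum_if_norm_less[OF selfadjoint_bounded_ops[OF A]] not_le by auto
  moreover have "norm A \<in> insert 0 (cmod ` spectrum A)"
    using selfadjoint_norm_in_spectrum[OF A] by (cases "A = 0") force+
  ultimately show ?thesis
    unfolding spectral_radius_def by (intro cSup_eq_maximum)
qed

section \<open>Orthogonal projections\<close>

text \<open>Built on the real \<open>subspace\<close>, so that the real nearest point result applies
  directly.\<close>

definition csubspace :: "'a::complex_hilbert_space set \<Rightarrow> bool" where
  "csubspace M \<longleftrightarrow> subspace M \<and> (\<forall>c. \<forall>x\<in>M. c *\<^sub>C x \<in> M)"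

lemma csubspace_op_range:
  assumes "A \<in> bounded_ops"
  shows "csubspace (op_range A)"
  unfolding csubspace_def
proof (intro conjI allI ballI)
  show "subspace (op_range A)"
    by (intro linear_subspace_image bounded_linear.linear blinfun.bounded_linear_right) simp
  fix c x
  assume "x \<in> op_range A"
  then show "c *\<^sub>C x \<in> op_range A"
    using bounded_ops_scaleC[OF assms] by (metis imageE rangeI)
qed

text \<open>Invariance of \<open>M\<close> under \<open>\<i>\<close> makes real orthogonality to
  \<open>M\<close> imply complex orthogonality.\<close>

lemma orth_compl_csubspace:
  assumes "csubspace M"
  shows "orth_compl M = {x. \<forall>y\<in>M. inner x y = 0}"
proof -
  have "cinner x y = 0" if "\<forall>y\<in>M. inner x y = 0" "y \<in> M" for x y
    using that assms by (intro complex_eqI) (auto simp: csubspace_def Im_cinner simp flip: inner_eq_Re_cinner)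
  then show ?thesis
    by (auto simp: orth_compl_def inner_eq_Re_cinner)
qed

text \<open>The nearest point map \<open>p\<close> is characterised by membership and orthogonality.
  This uniqueness yields its linearity and identifies it with the operator described in
  \<open>orth_proj\<close>.\<close>

lemma
  assumes "closed M" and M: "csubspace M"
  shows orth_proj_bounded_ops: "orth_proj M \<in> bounded_ops"
    and orth_proj_mem: "orth_proj M x \<in> M"
    and orth_proj_orthogonal: "y \<in> M \<Longrightarrow> inner (x - orth_proj M x) y = 0"
    and norm_orth_proj_le: "norm (orth_proj M x) \<le> norm x"
    and orth_proj_eqI:
      "m \<in> M \<Longrightarrow> (\<And>y. y \<in> M \<Longrightarrow> inner (x - m) y = 0) \<Longrightarrow> orth_proj M x = m"
proof -
  have sub: "subspace M" and scaleC: "\<And>c x. x \<in> M \<Longrightarrow> c *\<^sub>C x \<in> M"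
    using M by (auto simp: csubspace_def)
  have "\<exists>m\<in>M. \<forall>y\<in>M. inner (x - m) y = 0" for x
    using closed_subspace_decomposition[OF \<open>closed M\<close> sub] by metis
  then obtain p where p: "\<And>x. p x \<in> M" "\<And>x y. y \<in> M \<Longrightarrow> inner (x - p x) y = 0"
    by metis
  have unique: "m = p x" if "m \<in> M" "\<And>y. y \<in> M \<Longrightarrow> inner (x - m) y = 0" for x m
  proof -
    have "p x - m \<in> M"
      by (intro subspace_diff sub p that)
    \<comment> \<open>The left side is \<open>inner (p x - m) (p x - m)\<close>.\<close>
    then have "inner (x - m) (p x - m) - inner (x - p x) (p x - m) = 0"
      using that p by simp
    then show ?thesis
      by (simp flip: inner_diff_left)
  qed
  have p_norm: "norm (p x) \<le> norm x" for x
  proof -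
    have "norm (p x) * norm (p x) = inner x (p x)"
      using p(2)[OF p(1), of x x] by (simp add: inner_diff_left flip: power2_norm_eq_inner power2_eq_square)
    also have "\<dots> \<le> norm x * norm (p x)"
      by (rule norm_cauchy_schwarz)
    finally show ?thesis
      by (cases "p x = 0") auto
  qed
  have p_scaleC: "p (c *\<^sub>C x) = c *\<^sub>C p x" for c x
  proof (rule unique[symmetric])
    fix y
    assume "y \<in> M"
    have "inner (c *\<^sub>C x - c *\<^sub>C p x) y = inner (x - p x) (cnj c *\<^sub>C y)"
      by (simp add: inner_scaleC_right scaleC_diff_right)
    then show "inner (c *\<^sub>C x - c *\<^sub>C p x) y = 0"
      using p(2) scaleC[OF \<open>y \<in> M\<close>] by simp
  qed (intro scaleC p)
  have "bounded_linear p"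
  proof (rule bounded_linear_intro)
    show "p (x + y) = p x + p y" for x y
    proof (rule unique[symmetric])
      fix z
      assume "z \<in> M"
      then show "inner (x + y - (p x + p y)) z = 0"
        using p(2)[of z x] p(2)[of z y] by (simp add: inner_simps)
    qed (intro subspace_add sub p)
    show "p (r *\<^sub>R x) = r *\<^sub>R p x" for r x
      using p_scaleC[of "of_real r" x] by (simp add: scaleC_of_real)
    show "norm (p x) \<le> norm x * 1" for x
      using p_norm by simp
  qed
  then have Bp: "blinfun_apply (Blinfun p) = p"
    by (rule bounded_linear_Blinfun_apply)
  have "orth_proj M = Blinfun p"
    unfolding orth_proj_def orth_compl_csubspace[OF M]
  proof (rule the_equality)
    show "Blinfun p \<in> bounded_ops \<and>
      (\<forall>x. Blinfun p x \<in> M \<and> x - Blinfun p x \<in> {x. \<forall>y\<in>M. inner x y = 0})"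
      by (simp add: Bp p bounded_ops_def p_scaleC)
  next
    fix P
    assume "P \<in> bounded_ops \<and> (\<forall>x. blinfun_apply P x \<in> M \<and> x - P x \<in> {x. \<forall>y\<in>M. inner x y = 0})"
    then show "P = Blinfun p"
      by (intro blinfun_eqI) (auto simp: Bp intro!: unique)
  qed
  then show "orth_proj M \<in> bounded_ops" "orth_proj M x \<in> M"
    "y \<in> M \<Longrightarrow> inner (x - orth_proj M x) y = 0" "norm (orth_proj M x) \<le> norm x"
    "m \<in> M \<Longrightarrow> (\<And>y. y \<in> M \<Longrightarrow> inner (x - m) y = 0) \<Longrightarrow> orth_proj M x = m"
    using unique by (simp_all add: Bp p bounded_ops_def p_scaleC p_norm)
qed

text \<open>Both sides of the symmetry identity equal \<open>inner (?P x) (?P y)\<close>.\<close>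

lemma selfadjoint_orth_proj:
  assumes "closed M" and M: "csubspace M"
  shows "selfadjoint (orth_proj M)"
proof -
  let ?P = "orth_proj M"
  have 1: "inner z (?P y) = inner (?P z) (?P y)" for y z
    using orth_proj_orthogonal[OF assms orth_proj_mem[OF assms], of z y] by (simp add: inner_diff_left)
  have "inner (?P x) y = inner x (?P y)" for x y
    using 1[of x y] 1[of y x] by (simp add: inner_commute)
  then show ?thesis
    by (simp add: selfadjoint_iff_inner orth_proj_bounded_ops assms)
qed

section \<open>Positive orthogonal decompositions\<close>

text \<open>This symmetry transfers results on the first component to the second.\<close>

lemma positive_orthogonal_decomposition_uminus:
  assumes "positive_orthogonal_decomposition T T1 T2"
  shows "positive_orthogonal_decomposition (- T) T2 T1"
proof -
  have "op_range (- T) = op_range T"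
  proof -
    have "(- T) x = T (- x)" for x
      by (simp add: blinfun.bilinear_simps)
    then show ?thesis
      by (auto simp: image_iff) (metis minus_minus)+
  qed
  moreover have "cinner y x = 0 \<longleftrightarrow> cinner x y = 0" for x y :: 'a
    by (metis cinner_commute complex_cnj_zero)
  moreover have "{x + y |x y. x \<in> M \<and> y \<in> N} = {x + y |x y. x \<in> N \<and> y \<in> M}" for M N :: "'a set"
    by (auto; metis add.commute)
  ultimately show ?thesis
    using assms unfolding positive_orthogonal_decomposition_def orthogonal_sum_def
    by (metis minus_diff_eq)
qed

text \<open>For \<open>y\<close> in the closure of the range of \<open>T1\<close>, write \<open>y = T z\<close>; then \<open>y - T1 z = - T2 z\<close>
  lies in two orthogonal subspaces.\<close>

lemma positive_orthogonal_decomposition_closed_range: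
  assumes dec: "positive_orthogonal_decomposition T T1 T2" and "closed (op_range T)"
  shows "closed (op_range T1)"
proof -
  have orth: "inner x y = 0" if "x \<in> closure (op_range T1)" "y \<in> closure (op_range T2)" for x y
    using dec that
    by (simp add: positive_orthogonal_decomposition_def orthogonal_sum_def inner_eq_Re_cinner)
  have "y \<in> op_range T1" if y: "y \<in> closure (op_range T1)" for y
  proof -
    have "0 \<in> closure (op_range T2)"
      using closure_subset by (metis blinfun.zero_right rangeI subsetD)
    then have "y + 0 \<in> op_range T"
      using dec y \<open>closed (op_range T)\<close>
      unfolding positive_orthogonal_decomposition_def orthogonal_sum_def closure_closed[OF \<open>closed (op_range T)\<close>]
      by blast
    then obtain z where "y = T1 z - T2 z"
      using dec by (auto simp: positive_orthogonal_decomposition_def blinfun.diff_left)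
    moreover have "inner y (T2 z) = 0" "inner (T1 z) (T2 z) = 0"
      using orth y closure_subset by (blast intro: rangeI)+
    ultimately have "inner (T2 z) (T2 z) = 0"
      by (simp add: inner_diff_left)
    then show ?thesis
      using \<open>y = T1 z - T2 z\<close> by simp
  qed
  then show ?thesis
    by (metis closure_subset closure_closed closed_closure subsetI subset_antisym)
qed

text \<open>One direction is the triangle inequality with \<open>norm ?P \<le> 1\<close>. For the
  other, on the range \<open>(norm (x - A x))^2 \<le> (norm x)^2 - (2 - norm A) * inner (A x)
  x\<close>, where the inner product is bounded below by a multiple of
  \<open>(norm x)^2\<close>.\<close>

lemma positive_op_norm_proj_diff_less_1_iff:
  assumes A: "positive_op A" and closed: "closed (op_range A)"
  shows "norm (range_proj A - A) < 1 \<longleftrightarrow> norm A < 2"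
proof
  let ?P = "range_proj A"
  have sa: "selfadjoint A" and pos: "\<And>x. 0 \<le> inner (A x) x"
    using A by (auto simp: positive_op_iff_inner)
  have sub: "csubspace (op_range A)"
    by (intro csubspace_op_range selfadjoint_bounded_ops sa)
  have P: "?P = orth_proj (op_range A)"
    by (simp add: range_proj_def closed)
  have P_norm: "norm (?P x) \<le> norm x" for x
    unfolding P by (rule norm_orth_proj_le[OF closed sub])
  have AP: "A (?P x) = A x" for x
  proof -
    have "inner (A (?P x)) y = inner (A x) y" for y
      using orth_proj_orthogonal[OF closed sub, of "A y" x]
      by (simp add: selfadjoint_inner[OF sa] P inner_diff_left)
    then show ?thesis
      using vector_eq_rdot by blast
  qed
  have PP: "?P (?P x) = ?P x" for x
    unfolding P by (rule orth_proj_eqI) (auto simp: closed sub orth_proj_mem)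
  {
    assume less: "norm (?P - A) < 1"
    have "norm ?P \<le> 1"
      using P_norm by (intro norm_blinfun_bound) auto
    moreover have "norm A \<le> norm ?P + norm (?P - A)"
      using norm_triangle_ineq4[of ?P "?P - A"] by simp
    ultimately show "norm A < 2"
      using less by linarith
  next
    assume less: "norm A < 2"
    obtain c where "0 < c" and c: "\<And>x. x \<in> op_range A \<Longrightarrow> c * norm x \<le> norm (A x)"
      using symmetric_closed_range_bounded_below[OF selfadjoint_inner[OF sa] closed] by blast
    define L where "L = norm A"
    have L: "0 \<le> L" "L < 2"
      using less by (simp_all add: L_def)
    \<comment> \<open>The denominator \<open>L + 1\<close> instead of \<open>L\<close> stays
      positive even when \<open>A = 0\<close>.\<close>
    define q where "q = 1 - (2 - L) * (c\<^sup>2 / (L + 1))"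
    have "q < 1"
      using L \<open>0 < c\<close> by (simp add: q_def)
    have bound: "(norm (x - A x))\<^sup>2 \<le> q * (norm x)\<^sup>2" if "x \<in> op_range A" for x
    proof -
      define w where "w = inner (A x) x"
      have w: "(norm (A x))\<^sup>2 \<le> L * w" "0 \<le> w"
        using positive_norm_square_le[OF selfadjoint_inner[OF sa] pos] pos by (simp_all add: L_def w_def)
      have "c\<^sup>2 * (norm x)\<^sup>2 \<le> (norm (A x))\<^sup>2"
        using power_mono[OF c[OF that], of 2] \<open>0 < c\<close> by (simp add: power_mult_distrib)
      also have "\<dots> \<le> (L + 1) * w"
        using w by (simp add: algebra_simps)
      finally have "c\<^sup>2 / (L + 1) * (norm x)\<^sup>2 \<le> w"
        using L by (simp add: field_simps)
      then have "(2 - L) * (c\<^sup>2 / (L + 1) * (norm x)\<^sup>2) \<le> (2 - L) * w"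
        using L by (intro mult_left_mono) auto
      moreover have "(norm (x - A x))\<^sup>2 = (norm x)\<^sup>2 - 2 * w + (norm (A x))\<^sup>2"
        by (simp add: power2_norm_eq_inner w_def inner_diff_left inner_diff_right inner_commute)
      ultimately show ?thesis
        using w by (simp add: q_def algebra_simps)
    qed
    \<comment> \<open>Since \<open>A x = A (?P x)\<close> and \<open>?P\<close> does not increase
      norms, the bound on the range suffices.\<close>
    have "norm (?P - A) \<le> sqrt (max 0 q)"
    proof (rule norm_blinfun_bound)
      fix x
      have "(norm (?P x - A (?P x)))\<^sup>2 \<le> q * (norm (?P x))\<^sup>2"
        unfolding P by (intro bound orth_proj_mem closed sub)
      also have "\<dots> \<le> max 0 q * (norm x)\<^sup>2"
        using P_norm[of x] by (intro mult_mono power_mono) auto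
      finally have "norm (?P x - A (?P x)) \<le> sqrt (max 0 q * (norm x)\<^sup>2)"
        by (rule real_le_rsqrt)
      then show "norm ((?P - A) x) \<le> sqrt (max 0 q) * norm x"
        by (simp add: real_sqrt_mult blinfun.diff_left AP)
    qed simp
    also have "\<dots> < 1"
      using \<open>q < 1\<close> by simp
    finally show "norm (?P - A) < 1" .
  }
qed

theorem corollary4p5:
  fixes T T1 T2 U V :: "'a::complex_hilbert_space \<Rightarrow>\<^sub>L 'a"
  assumes "selfadjoint T"
    and "closed (op_range T)"
    and "positive_orthogonal_decomposition T T1 T2"
    and "polar_splitting T U V"
  shows "(convergent_proper_splitting T U V \<longleftrightarrow>
        max (norm (range_proj T1 - T1)) (norm (range_proj T2 - T2)) < 1) \<and>
      (max (norm (range_proj T1 - T1)) (norm (range_proj T2 - T2)) < 1 \<longleftrightarrow>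
        norm T1 < 2 \<and> norm T2 < 2)"
proof -

  \<comment> \<open>Relations between the two parts and their range projections\<close>
  define P1 where "P1 = range_proj T1"
  define P2 where "P2 = range_proj T2"
  have T: "T = T1 - T2" and pos: "positive_op T1" "positive_op T2"
    using assms(3) by (auto simp: positive_orthogonal_decomposition_def)
  have sa: "selfadjoint T1" "selfadjoint T2"
    using pos by (auto simp: positive_op_def)
  have closed: "closed (op_range T1)" "closed (op_range T2)"
    using positive_orthogonal_decomposition_closed_range[OF assms(3,2)]
      positive_orthogonal_decomposition_closed_range[OF positive_orthogonal_decomposition_uminus[OF assms(3)]]
      assms(2)
    by (auto simp: blinfun.minus_left closed_negations[of "op_range T", simplified image_image])
  have sub: "csubspace (op_range T1)" "csubspace (op_range T2)"
    by (intro csubspace_op_range selfadjoint_bounded_ops sa)+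
  have P_def: "P1 = orth_proj (op_range T1)" "P2 = orth_proj (op_range T2)"
    by (simp_all add: P1_def P2_def range_proj_def closed)
  have saP: "selfadjoint P1" "selfadjoint P2"
    by (simp_all add: P_def selfadjoint_orth_proj closed sub)
  have range_P: "P1 x \<in> op_range T1" "P2 x \<in> op_range T2" for x
    by (simp_all add: P_def orth_proj_mem closed sub)
  have P_id: "x \<in> op_range T1 \<Longrightarrow> P1 x = x" "x \<in> op_range T2 \<Longrightarrow> P2 x = x" for x
    unfolding P_def by (auto intro!: orth_proj_eqI simp: closed sub)
  have orth: "inner x y = 0" if "x \<in> op_range T1" "y \<in> op_range T2" for x y
    using assms(3) that closure_subset[of "op_range T1"] closure_subset[of "op_range T2"]
    by (simp add: positive_orthogonal_decomposition_def orthogonal_sum_def inner_eq_Re_cinner subset_iff)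
  have orth': "inner y x = 0" if "x \<in> op_range T1" "y \<in> op_range T2" for x y
    using orth[OF that] by (simp add: inner_commute)
  have P_0: "P2 x = 0" if "x \<in> op_range T1" for x
    unfolding P_def
    by (rule orth_proj_eqI; use sub that in \<open>simp add: closed csubspace_def subspace_0 orth\<close>)
  have P_0': "P1 x = 0" if "x \<in> op_range T2" for x
    unfolding P_def
    by (rule orth_proj_eqI; use sub that in \<open>simp add: closed csubspace_def subspace_0 orth'\<close>)
  \<comment> \<open>By symmetry \<open>(norm (T2 x))^2 = inner x (T2 (T2 x))\<close>, which vanishes
    by orthogonality of the ranges.\<close>
  have T_0: "T2 x = 0" if "x \<in> op_range T1" for x
    using orth[OF that, of "T2 (T2 x)"] selfadjoint_inner[OF sa(2), of x "T2 x"] by simp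
  have T_0': "T1 x = 0" if "x \<in> op_range T2" for x
    using orth'[OF _ that, of "T1 (T1 x)"] selfadjoint_inner[OF sa(1), of x "T1 x"] by simp
  have TP: "T1 (P1 x) = T1 x" "T2 (P2 x) = T2 x" for x
  proof -
    have "inner (T1 (P1 x)) y = inner (T1 x) y" "inner (T2 (P2 x)) y = inner (T2 x) y" for y
      using orth_proj_orthogonal[OF closed(1) sub(1), of "T1 y" x]
        orth_proj_orthogonal[OF closed(2) sub(2), of "T2 y" x]
      by (simp_all add: selfadjoint_inner sa P_def inner_diff_left)
    then show "T1 (P1 x) = T1 x" "T2 (P2 x) = T2 x"
      using vector_eq_rdot by blast+
  qed
  have PT: "P1 (T1 x) = T1 x" "P2 (T2 x) = T2 x" "P1 (T2 x) = 0" "P2 (T1 x) = 0"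
    and TT: "T1 (T2 x) = 0" "T2 (T1 x) = 0"
    and TP': "T1 (P2 x) = 0" "T2 (P1 x) = 0"
    and PP: "P1 (P1 x) = P1 x" "P2 (P2 x) = P2 x" "P1 (P2 x) = 0" "P2 (P1 x) = 0" for x
    by (intro P_id P_0 P_0' T_0 T_0' range_P rangeI)+
  note simps = PT TT TP TP' PP

  \<comment> \<open>The modulus and the polar isometry\<close>
  have "op_abs T = T1 + T2"
    unfolding op_abs_def adj_selfadjoint[OF \<open>selfadjoint T\<close>]
  proof (rule op_sqrt_eqI)
    show "positive_op (T1 + T2)"
      by (intro positive_op_add pos)
    show "(T1 + T2) o\<^sub>L (T1 + T2) = T o\<^sub>L T"
      by (rule blinfun_eqI) (simp add: T blinfun.bilinear_simps simps)
  qed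
  then have U: "T = U o\<^sub>L (T1 + T2)" and null: "nullspace U = nullspace T" and V: "V = U - T"
    and U_op: "U \<in> bounded_ops"
    using assms(4) by (auto simp: polar_splitting_def polar_isometry_def partial_isometry_def)
  \<comment> \<open>The vector \<open>x\<close> splits into its components in the two ranges and a
    remainder in the nullspace of \<open>T\<close>. Evaluating \<open>T = U \<bar>T\<bar>\<close> at
    \<open>P1 z1\<close> and \<open>P2 z2\<close> isolates one range at a time.\<close>
  have U_eq: "U = P1 - P2"
  proof (rule blinfun_eqI)
    fix x
    obtain z1 z2 where z: "P1 x = T1 z1" "P2 x = T2 z2"
      using range_P[of x] by blast
    have TU: "T y = U (T1 y + T2 y)" for y
      using arg_cong[OF U, of "\<lambda>X. blinfun_apply X y"] by (simp add: blinfun.add_left)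
    have "U (P1 x) = P1 x"
      using TU[of "P1 z1"] by (simp add: z simps T blinfun.diff_left)
    moreover have "U (P2 x) = - P2 x"
      using TU[of "P2 z2"] by (simp add: z simps T blinfun.diff_left)
    moreover have "x - P1 x - P2 x \<in> nullspace U"
      unfolding null by (simp add: nullspace_def T blinfun.bilinear_simps simps)
    moreover have "U x = U (x - P1 x - P2 x) + U (P1 x) + U (P2 x)"
      by (simp add: blinfun.bilinear_simps)
    ultimately show "U x = (P1 - P2) x"
      by (simp add: nullspace_def blinfun.diff_left)
  qed
  have "op_range U = op_range T"
  proof (intro equalityI subsetI; clarify)
    fix x
    obtain z1 z2 where z: "P1 x = T1 z1" "P2 x = T2 z2"
      using range_P[of x] by blast
    have "T (P1 z1 + P2 z2) = U x"
      by (simp add: T U_eq blinfun.bilinear_simps simps z)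
    then show "U x \<in> op_range T"
      by (metis rangeI)
  next
    fix x
    have "U (T1 x + T2 x) = T x"
      by (simp add: T U_eq blinfun.bilinear_simps simps)
    then show "T x \<in> op_range U"
      by (metis rangeI)
  qed
  then have splitting: "proper_splitting T U V"
    using U_op null V assms(1)
    by (simp add: proper_splitting_def bounded_ops_diff selfadjoint_bounded_ops)

  \<comment> \<open>The Moore-Penrose inverse and the iteration operator\<close>
  have UU: "U o\<^sub>L U = P1 + P2"
    by (rule blinfun_eqI) (simp add: U_eq blinfun.bilinear_simps simps)
  have "pinv U = U"
  proof (rule pinv_eqI)
    show "U o\<^sub>L U o\<^sub>L U = U"
      by (rule blinfun_eqI) (simp add: U_eq blinfun.bilinear_simps simps)
    then show "U o\<^sub>L U o\<^sub>L U = U" .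
    show "selfadjoint (U o\<^sub>L U)"
      unfolding UU by (intro selfadjoint_add saP)
    then show "selfadjoint (U o\<^sub>L U)" .
  qed (rule U_op)
  \<comment> \<open>This is \<open>U (U - T)\<close>: here \<open>U U = P1 + P2\<close> and
    \<open>U T = T1 + T2\<close>.\<close>
  define W where "W = (P1 - T1) + (P2 - T2)"
  have W: "pinv U o\<^sub>L V = W"
    unfolding \<open>pinv U = U\<close>
    by (rule blinfun_eqI) (simp add: V W_def U_eq T blinfun.bilinear_simps simps)
  have "selfadjoint W"
    unfolding W_def by (intro selfadjoint_add selfadjoint_diff sa saP)
  then have radius: "spectral_radius (pinv U o\<^sub>L V) = norm W"
    by (simp add: W selfadjoint_spectral_radius)

  \<comment> \<open>The norm of the iteration operator\<close>
  define m where "m = max (norm (P1 - T1)) (norm (P2 - T2))"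
  have "norm W = m"
  proof (rule antisym)
    have "0 \<le> m"
      by (simp add: m_def le_max_iff_disj)
    show "norm W \<le> m"
    proof (rule norm_blinfun_bound[OF \<open>0 \<le> m\<close>])
      fix x
      \<comment> \<open>The vectors \<open>a\<close> and \<open>b\<close> are the components of
        \<open>W x\<close> in the two orthogonal ranges, so Pythagoras combines their separate
        bounds.\<close>
      define a where "a = (P1 - T1) (P1 x)"
      define b where "b = (P2 - T2) (P2 x)"
      have pyth: "(norm (u + v))\<^sup>2 = (norm u)\<^sup>2 + (norm v)\<^sup>2" if "inner u v = 0" for u v :: 'a
        using that by (simp add: power2_norm_eq_inner inner_simps inner_commute)
      have Wx: "W x = a + b"
        by (simp add: W_def a_def b_def blinfun.bilinear_simps simps)
      have "P1 a = a" "P2 b = b"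
        by (simp_all add: a_def b_def blinfun.bilinear_simps simps)
      then have ab: "a \<in> op_range T1" "b \<in> op_range T2"
        using range_P(1)[of a] range_P(2)[of b] by simp_all
      have "norm a \<le> m * norm (P1 x)"
        unfolding a_def m_def by (rule order_trans[OF norm_blinfun]) (simp add: mult_right_mono)
      then have "(norm a)\<^sup>2 \<le> m\<^sup>2 * (norm (P1 x))\<^sup>2"
        by (metis norm_ge_zero power_mono power_mult_distrib)
      moreover have "norm b \<le> m * norm (P2 x)"
        unfolding b_def m_def by (rule order_trans[OF norm_blinfun]) (simp add: mult_right_mono)
      then have "(norm b)\<^sup>2 \<le> m\<^sup>2 * (norm (P2 x))\<^sup>2"
        by (metis norm_ge_zero power_mono power_mult_distrib)
      ultimately have "(norm (W x))\<^sup>2 \<le> m\<^sup>2 * (norm (P1 x + P2 x))\<^sup>2"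
        unfolding Wx
        using pyth[OF orth[OF ab]] pyth[OF orth[OF range_P, of x x]]
        by (simp add: algebra_simps)
      moreover have "(norm (P1 x + P2 x))\<^sup>2 \<le> (norm x)\<^sup>2"
      proof -
        have "inner (P1 x + P2 x) (x - (P1 x + P2 x)) = 0"
          using selfadjoint_inner[OF saP(1), of x "x - (P1 x + P2 x)"]
            selfadjoint_inner[OF saP(2), of x "x - (P1 x + P2 x)"]
          by (simp add: inner_add_left blinfun.bilinear_simps simps)
        from pyth[OF this] show ?thesis
          by simp
      qed
      then have "m\<^sup>2 * (norm (P1 x + P2 x))\<^sup>2 \<le> m\<^sup>2 * (norm x)\<^sup>2"
        by (intro mult_left_mono) auto
      ultimately have "(norm (W x))\<^sup>2 \<le> (m * norm x)\<^sup>2"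
        by (simp add: power_mult_distrib)
      then show "norm (W x) \<le> m * norm x"
        by (rule power2_le_imp_le) (simp add: \<open>0 \<le> m\<close>)
    qed
    \<comment> \<open>Each summand is \<open>W\<close> preceded by a projection, which does not
      increase norms.\<close>
    have "norm (P1 - T1) \<le> norm W"
    proof (rule norm_blinfun_bound)
      fix x
      have "(P1 - T1) x = W (P1 x)"
        by (simp add: W_def blinfun.bilinear_simps simps)
      also have "norm \<dots> \<le> norm W * norm (P1 x)"
        by (rule norm_blinfun)
      also have "\<dots> \<le> norm W * norm x"
        by (intro mult_left_mono) (simp_all add: P_def norm_orth_proj_le closed sub)
      finally show "norm ((P1 - T1) x) \<le> norm W * norm x" .
    qed simp
    moreover have "norm (P2 - T2) \<le> norm W"
    proof (rule norm_blinfun_bound)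
      fix x
      have "(P2 - T2) x = W (P2 x)"
        by (simp add: W_def blinfun.bilinear_simps simps)
      also have "norm \<dots> \<le> norm W * norm (P2 x)"
        by (rule norm_blinfun)
      also have "\<dots> \<le> norm W * norm x"
        by (intro mult_left_mono) (simp_all add: P_def norm_orth_proj_le closed sub)
      finally show "norm ((P2 - T2) x) \<le> norm W * norm x" .
    qed simp
    ultimately show "m \<le> norm W"
      by (simp add: m_def)
  qed
  then have "convergent_proper_splitting T U V \<longleftrightarrow> m < 1"
    by (simp add: convergent_proper_splitting_def splitting radius)
  then show ?thesis
    using positive_op_norm_proj_diff_less_1_iff[OF pos(1) closed(1)]
      positive_op_norm_proj_diff_less_1_iff[OF pos(2) closed(2)]
    by (simp add: m_def P1_def P2_def)
qed

end
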